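(* Let $T$ be a set of $LCL$-formulas and $\alpha$ an $LCL$-formula. If $T\vdash\alpha$, then $T\models\alpha$.
   Context: $CL$-terms: $M,N ::= x \mid \mathsf{S} \mid \mathsf{K} \mid \mathsf{I} \mid MN$ over a countable set $V$ of term variables; $FV(M)$ is the set of variables of $M$. $M=_{w,\eta}N$ means $M=N$ is provable in the equational theory $\mathcal{EQ}^\eta$ with axioms $M=M$, $\mathsf S MNL=(ML)(NL)$, $\mathsf K MN=M$, $\mathsf I M=M$ and rules of symmetry, transitivity, $M=N\Rightarrow MP=NP$, $M=N\Rightarrow PM=PN$, and extensionality (from $Mx=Nx$, $x\notin FV(M)\cup FV(N)$, infer $M=N$). Simple types $\sigma ::= a\mid\sigma\to\tau$ (set ${\sf Types}$). A basis is a set of declarations $x:\sigma$ with distinct variables; $CL_\rightarrow$ is the set of statements $M:\sigma$ derivable from some basis in simply typed combinatory logic (rules: $x:\sigma$ if $x:\sigma\in\Gamma$; $\mathsf S:(\sigma\to(\rho\to\tau))\to((\sigma\to\rho)\to(\sigma\to\tau))$; $\mathsf K:\sigma\to(\tau\to\sigma)$; $\mathsf I:\sigma\to\sigma$; from $M:\sigma\to\tau$, $N:\sigma$ infer $MN:\tau$). $LCL$-formulas: $\alpha,\beta ::= M:\sigma\mid\neg\alpha\mid\alpha\Rightarrow\beta$ with $M:\sigma\in CL_\rightarrow$ ($\wedge$ etc. defined classically). Axioms: (Ax1) $\mathsf S:(\sigma\to(\tau\to\rho))\to((\sigma\to\tau)\to(\sigma\to\rho))$; (Ax2) $\mathsf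 K:\sigma\to(\tau\to\sigma)$; (Ax3) $\mathsf I:\sigma\to\sigma$; (Ax4) $(M:\sigma\to\tau)\Rightarrow((N:\sigma)\Rightarrow(MN:\tau))$ when the three statements are in $CL_\rightarrow$; (Ax5) $M:\sigma\Rightarrow N:\sigma$ when $M=_{w,\eta}N$ and both statements are in $CL_\rightarrow$; (Ax6) $\alpha\Rightarrow(\beta\Rightarrow\alpha)$; (Ax7) $(\alpha\Rightarrow(\beta\Rightarrow\gamma))\Rightarrow((\alpha\Rightarrow\beta)\Rightarrow(\alpha\Rightarrow\gamma))$; (Ax8) $(\neg\alpha\Rightarrow\neg\beta)\Rightarrow((\neg\alpha\Rightarrow\beta)\Rightarrow\alpha)$; rule Modus Ponens. $T\vdash\alpha$: a finite sequence ending in $\alpha$ of axiom instances, members of $T$ and Modus Ponens consequences of earlier members. Semantics: an applicative structure for $LCL$ is $\langle D,\{A^\sigma\}_{\sigma\in{\sf Types}},\cdot,\mathbf s,\mathbf k,\mathbf i\rangle$ with $D$ nonempty, $A^\sigma\subseteq D$, $\cdot:D\times D\to D$ extensional (if $d_1\cdot e=d_2\cdot e$ for all $e$ then $d_1=d_2$) and mapping $A^{\sigma\to\tau}\times A^\sigma$ into $A^\tau$; $\mathbf s\in A^{(\sigma\to(\tau\to\rho))\to((\sigma\to\tau)\to(\sigma\to\rho))}$ for all $\sigma,\tau,\rho$ with $((\mathbf s\cdot d)\cdot e)\cdot f=(d\cdot f)\cdot(e\cdot f)$; $\mathbf k\in A^{\sigma\to(\tau\to\sigma)}$ for all $\sigma,\tau$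 with $(\mathbf k\cdot d)\cdot e=d$; $\mathbf i\in A^{\sigma\to\sigma}$ for all $\sigma$ with $\mathbf i\cdot d=d$. An $LCL$-model $\mathcal M_\rho$ is an applicative structure with an environment $\rho:V\to D$. Interpretation: $[\![x]\!]_\rho=\rho(x)$, $[\![\mathsf S]\!]_\rho=\mathbf s$, $[\![\mathsf K]\!]_\rho=\mathbf k$, $[\![\mathsf I]\!]_\rho=\mathbf i$, $[\![MN]\!]_\rho=[\![M]\!]_\rho\cdot[\![N]\!]_\rho$. Satisfaction: $\mathcal M_\rho\models M:\sigma$ iff $[\![M]\!]_\rho\in A^\sigma$; $\neg$ and $\Rightarrow$ (and $\wedge$) are interpreted classically. $T\models\alpha$ iff every model satisfying all formulas of $T$ satisfies $\alpha$. *)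

theory Defs
  imports Main "HOL-Library.Countable"
begin

datatype 'v cl_term =
    Var 'v
  | CombS
  | CombK
  | CombI
  | App "'v cl_term" "'v cl_term"  (infixl \<open>\<star>\<close> 200)

primrec FV :: "'v cl_term \<Rightarrow> 'v set" where
  "FV (Var x) = {x}"
| "FV CombS = {}"
| "FV CombK = {}"
| "FV CombI = {}"
| "FV (M \<star> N) = FV M \<union> FV N"

inductive eq_w_eta :: "'v cl_term \<Rightarrow> 'v cl_term \<Rightarrow> bool"  (infix \<open>=\<^sub>w\<^sub>\<eta>\<close> 50) where
  eq_refl: "M =\<^sub>w\<^sub>\<eta> M"
| eq_S: "CombS \<star> M \<star> N \<star> L =\<^sub>w\<^sub>\<eta> (M \<star> L) \<star> (N \<star> L)"
| eq_K: "CombK \<star> M \<star> N =\<^sub>w\<^sub>\<eta> M"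
| eq_I: "CombI \<star> M =\<^sub>w\<^sub>\<eta> M"
| eq_sym: "M =\<^sub>w\<^sub>\<eta> N \<Longrightarrow> N =\<^sub>w\<^sub>\<eta> M"
| eq_trans: "M =\<^sub>w\<^sub>\<eta> N \<Longrightarrow> N =\<^sub>w\<^sub>\<eta> L \<Longrightarrow> M =\<^sub>w\<^sub>\<eta> L"
| eq_appL: "M =\<^sub>w\<^sub>\<eta> N \<Longrightarrow> M \<star> P =\<^sub>w\<^sub>\<eta> N \<star> P"
| eq_appR: "M =\<^sub>w\<^sub>\<eta> N \<Longrightarrow> P \<star> M =\<^sub>w\<^sub>\<eta> P \<star> N"
| eq_ext: "M \<star> Var x =\<^sub>w\<^sub>\<eta> N \<star> Var x \<Longrightarrow> x \<notin> FV M \<union> FV N \<Longrightarrow> M =\<^sub>w\<^sub>\<eta> N"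

datatype 'a ty =
    Atom 'a
  | Arrow "'a ty" "'a ty"  (infixr \<open>\<rightarrow>\<^sub>t\<close> 150)

definition basis :: "('v \<times> 'a ty) set \<Rightarrow> bool" where
  "basis \<Gamma> \<longleftrightarrow> single_valued \<Gamma>"

inductive has_type :: "('v \<times> 'a ty) set \<Rightarrow> 'v cl_term \<Rightarrow> 'a ty \<Rightarrow> bool" for \<Gamma> where
  ty_var: "(x, \<sigma>) \<in> \<Gamma> \<Longrightarrow> has_type \<Gamma> (Var x) \<sigma>"
| ty_S: "has_type \<Gamma> CombS
    ((\<sigma> \<rightarrow>\<^sub>t (\<rho> \<rightarrow>\<^sub>t \<tau>)) \<rightarrow>\<^sub>t ((\<sigma> \<rightarrow>\<^sub>t \<rho>) \<rightarrow>\<^sub>t (\<sigma> \<rightarrow>\<^sub>t \<tau>)))"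
| ty_K: "has_type \<Gamma> CombK (\<sigma> \<rightarrow>\<^sub>t (\<tau> \<rightarrow>\<^sub>t \<sigma>))"
| ty_I: "has_type \<Gamma> CombI (\<sigma> \<rightarrow>\<^sub>t \<sigma>)"
| ty_app: "has_type \<Gamma> M (\<sigma> \<rightarrow>\<^sub>t \<tau>) \<Longrightarrow> has_type \<Gamma> N \<sigma> \<Longrightarrow> has_type \<Gamma> (M \<star> N) \<tau>"

definition CL_arrow :: "('v cl_term \<times> 'a ty) set" where
  "CL_arrow = {(M, \<sigma>). \<exists>\<Gamma>. basis \<Gamma> \<and> has_type \<Gamma> M \<sigma>}"

text \<open>Raw formulas; the formulas of LCL are those whose atomic statements all lie in
  \<open>CL_arrow\<close>, each possibly typed from a different basis.\<close>

datatype ('v, 'a) form =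
    Stmt "'v cl_term" "'a ty"  (infix \<open>:\<^sub>t\<close> 140)
  | Neg "('v, 'a) form"  (\<open>\<sim> _\<close> [135] 135)
  | Imp "('v, 'a) form" "('v, 'a) form"  (infixr \<open>\<Rightarrow>\<^sub>f\<close> 130)

inductive_set LCL_formulas :: "('v, 'a) form set" where
  LCL_Stmt: "(M, \<sigma>) \<in> CL_arrow \<Longrightarrow> (M :\<^sub>t \<sigma>) \<in> LCL_formulas"
| LCL_Neg: "\<alpha> \<in> LCL_formulas \<Longrightarrow> (\<sim> \<alpha>) \<in> LCL_formulas"
| LCL_Imp: "\<alpha> \<in> LCL_formulas \<Longrightarrow> \<beta> \<in> LCL_formulas \<Longrightarrow> (\<alpha> \<Rightarrow>\<^sub>f \<beta>) \<in> LCL_formulas"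

inductive_set LCL_axioms :: "('v, 'a) form set" where
  Ax1: "(CombS :\<^sub>t (\<sigma> \<rightarrow>\<^sub>t (\<tau> \<rightarrow>\<^sub>t \<rho>)) \<rightarrow>\<^sub>t ((\<sigma> \<rightarrow>\<^sub>t \<tau>) \<rightarrow>\<^sub>t (\<sigma> \<rightarrow>\<^sub>t \<rho>))) \<in> LCL_axioms"
| Ax2: "(CombK :\<^sub>t \<sigma> \<rightarrow>\<^sub>t (\<tau> \<rightarrow>\<^sub>t \<sigma>)) \<in> LCL_axioms"
| Ax3: "(CombI :\<^sub>t \<sigma> \<rightarrow>\<^sub>t \<sigma>) \<in> LCL_axioms"
| Ax4: "(M, \<sigma> \<rightarrow>\<^sub>t \<tau>) \<in> CL_arrow \<Longrightarrow> (N, \<sigma>) \<in> CL_arrow \<Longrightarrow> (M \<star> N, \<tau>) \<in> CL_arrow \<Longrightarrow>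
    (M :\<^sub>t \<sigma> \<rightarrow>\<^sub>t \<tau> \<Rightarrow>\<^sub>f (N :\<^sub>t \<sigma> \<Rightarrow>\<^sub>f M \<star> N :\<^sub>t \<tau>)) \<in> LCL_axioms"
| Ax5: "M =\<^sub>w\<^sub>\<eta> N \<Longrightarrow> (M, \<sigma>) \<in> CL_arrow \<Longrightarrow> (N, \<sigma>) \<in> CL_arrow \<Longrightarrow>
    (M :\<^sub>t \<sigma> \<Rightarrow>\<^sub>f N :\<^sub>t \<sigma>) \<in> LCL_axioms"
| Ax6: "\<alpha> \<in> LCL_formulas \<Longrightarrow> \<beta> \<in> LCL_formulas \<Longrightarrow>
    (\<alpha> \<Rightarrow>\<^sub>f (\<beta> \<Rightarrow>\<^sub>f \<alpha>)) \<in> LCL_axioms"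
| Ax7: "\<alpha> \<in> LCL_formulas \<Longrightarrow> \<beta> \<in> LCL_formulas \<Longrightarrow> \<gamma> \<in> LCL_formulas \<Longrightarrow>
    ((\<alpha> \<Rightarrow>\<^sub>f (\<beta> \<Rightarrow>\<^sub>f \<gamma>)) \<Rightarrow>\<^sub>f ((\<alpha> \<Rightarrow>\<^sub>f \<beta>) \<Rightarrow>\<^sub>f (\<alpha> \<Rightarrow>\<^sub>f \<gamma>))) \<in> LCL_axioms"
| Ax8: "\<alpha> \<in> LCL_formulas \<Longrightarrow> \<beta> \<in> LCL_formulas \<Longrightarrow>
    ((\<sim> \<alpha> \<Rightarrow>\<^sub>f \<sim> \<beta>) \<Rightarrow>\<^sub>f ((\<sim> \<alpha> \<Rightarrow>\<^sub>f \<beta>) \<Rightarrow>\<^sub>f \<alpha>)) \<in> LCL_axioms"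

definition is_proof :: "('v, 'a) form set \<Rightarrow> ('v, 'a) form list \<Rightarrow> bool" where
  "is_proof T \<alpha>s \<longleftrightarrow>
     (\<forall>i < length \<alpha>s. \<alpha>s ! i \<in> LCL_axioms \<or> \<alpha>s ! i \<in> T \<or>
        (\<exists>j < i. \<exists>k < i. \<alpha>s ! k = ((\<alpha>s ! j) \<Rightarrow>\<^sub>f (\<alpha>s ! i))))"

definition provable :: "('v, 'a) form set \<Rightarrow> ('v, 'a) form \<Rightarrow> bool"  (infix \<open>\<turnstile>\<close> 50) where
  "T \<turnstile> \<alpha> \<longleftrightarrow> (\<exists>\<alpha>s. \<alpha>s \<noteq> [] \<and> last \<alpha>s = \<alpha> \<and> is_proof T \<alpha>s)"

record ('a, 'd) app_struct =
  carrier :: "'d set"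
  tyset :: "'a ty \<Rightarrow> 'd set"
  appl :: "'d \<Rightarrow> 'd \<Rightarrow> 'd"
  elS :: 'd
  elK :: 'd
  elI :: 'd

text \<open>That \<open>elS\<close>, \<open>elK\<close> and \<open>elI\<close> lie in the carrier follows from their membership in the
  sets \<open>tyset\<close>, since the type of types is nonempty.\<close>

definition applicative_structure :: "('a, 'd) app_struct \<Rightarrow> bool" where
  "applicative_structure S \<longleftrightarrow>
     (let D = carrier S; A = tyset S; ap = appl S; s = elS S; k = elK S; i = elI S in
       D \<noteq> {} \<and>
       (\<forall>\<sigma>. A \<sigma> \<subseteq> D) \<and>
       (\<forall>d\<in>D. \<forall>e\<in>D. ap d e \<in> D) \<and>
       (\<forall>d\<^sub>1\<in>D. \<forall>d\<^sub>2\<in>D. (\<forall>e\<in>D. ap d\<^sub>1 e = ap d\<^sub>2 e) \<longrightarrow> d\<^sub>1 = d\<^sub>2) \<and>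
       (\<forall>\<sigma> \<tau>. \<forall>d \<in> A (\<sigma> \<rightarrow>\<^sub>t \<tau>). \<forall>e \<in> A \<sigma>. ap d e \<in> A \<tau>) \<and>
       (\<forall>\<sigma> \<tau> \<rho>. s \<in> A ((\<sigma> \<rightarrow>\<^sub>t (\<tau> \<rightarrow>\<^sub>t \<rho>)) \<rightarrow>\<^sub>t ((\<sigma> \<rightarrow>\<^sub>t \<tau>) \<rightarrow>\<^sub>t (\<sigma> \<rightarrow>\<^sub>t \<rho>)))) \<and>
       (\<forall>d\<in>D. \<forall>e\<in>D. \<forall>f\<in>D. ap (ap (ap s d) e) f = ap (ap d f) (ap e f)) \<and>
       (\<forall>\<sigma> \<tau>. k \<in> A (\<sigma> \<rightarrow>\<^sub>t (\<tau> \<rightarrow>\<^sub>t \<sigma>))) \<and>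
       (\<forall>d\<in>D. \<forall>e\<in>D. ap (ap k d) e = d) \<and>
       (\<forall>\<sigma>. i \<in> A (\<sigma> \<rightarrow>\<^sub>t \<sigma>)) \<and>
       (\<forall>d\<in>D. ap i d = d))"

definition LCL_model :: "('a, 'd) app_struct \<Rightarrow> ('v \<Rightarrow> 'd) \<Rightarrow> bool" where
  "LCL_model S \<rho> \<longleftrightarrow> applicative_structure S \<and> (\<forall>x. \<rho> x \<in> carrier S)"

primrec interp :: "('a, 'd) app_struct \<Rightarrow> ('v \<Rightarrow> 'd) \<Rightarrow> 'v cl_term \<Rightarrow> 'd" where
  "interp S \<rho> (Var x) = \<rho> x"
| "interp S \<rho> CombS = elS S"
| "interp S \<rho> CombK = elK S"
| "interp S \<rho> CombI = elI S"
| "interp S \<rho> (M \<star> N) = appl S (interp S \<rho> M) (interp S \<rho> N)"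

primrec sat :: "('a, 'd) app_struct \<Rightarrow> ('v \<Rightarrow> 'd) \<Rightarrow> ('v, 'a) form \<Rightarrow> bool" where
  "sat S \<rho> (M :\<^sub>t \<sigma>) \<longleftrightarrow> interp S \<rho> M \<in> tyset S \<sigma>"
| "sat S \<rho> (\<sim> \<alpha>) \<longleftrightarrow> \<not> sat S \<rho> \<alpha>"
| "sat S \<rho> (\<alpha> \<Rightarrow>\<^sub>f \<beta>) \<longleftrightarrow> (sat S \<rho> \<alpha> \<longrightarrow> sat S \<rho> \<beta>)"

text \<open>HOL cannot quantify over types inside a formula, so the type of which the domains of the
  models are subsets is an explicit argument. Semantic consequence over all models is
  consequence for every type \<open>'d\<close>.\<close>

definition entails :: "'d itself \<Rightarrow> ('v, 'a) form set \<Rightarrow> ('v, 'a) form \<Rightarrow> bool" where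
  "entails _ T \<alpha> \<longleftrightarrow>
     (\<forall>(S :: ('a, 'd) app_struct) \<rho>.
        LCL_model S \<rho> \<longrightarrow> (\<forall>\<beta>\<in>T. sat S \<rho> \<beta>) \<longrightarrow> sat S \<rho> \<alpha>)"

end

theory Submission imports Defs
begin

text \<open>Every axiom is valid and modus ponens preserves satisfaction. The one axiom whose validity
  is not immediate is (Ax5): equality modulo weak reduction and extensionality is sound under
  every environment simultaneously. This uniformity is what makes the extensionality rule go
  through: a fresh variable may be sent to an arbitrary domain element without changing the
  interpretation of the two terms, and the domain is extensional.\<close>

lemma applicative_structure_constants_in_carrier:
  assumes "applicative_structure S"
  shows "elS S \<in> carrier S" "elK S \<in> carrier S" "elI S \<in> carrier S"
proof -
  have "tyset S \<sigma> \<subseteq> carrier S" for \<sigma>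
    using assms by (simp add: applicative_structure_def Let_def)
  moreover have "\<exists>\<sigma>. elS S \<in> tyset S \<sigma>" "\<exists>\<sigma>. elK S \<in> tyset S \<sigma>" "\<exists>\<sigma>. elI S \<in> tyset S \<sigma>"
    using assms unfolding applicative_structure_def Let_def by metis+
  ultimately show "elS S \<in> carrier S" "elK S \<in> carrier S" "elI S \<in> carrier S"
    by blast+
qed

text \<open>The laws of \<open>elS\<close>, \<open>elK\<close>, \<open>elI\<close> and
  extensionality are relative to the carrier, so using them on interpretations of terms requires
  this closure.\<close>

lemma interp_in_carrier:
  assumes "LCL_model S \<rho>"
  shows "interp S \<rho> M \<in> carrier S"
proof (induction M)
  case (App M N)
  then show ?case
    using assms by (auto simp: LCL_model_def applicative_structure_def Let_def)
qed (use assms in \<open>auto simp: LCL_model_def applicative_structure_constants_in_carrier\<close>)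

lemma interp_fun_upd_fresh: "x \<notin> FV M \<Longrightarrow> interp S (\<rho>(x := d)) M = interp S \<rho> M"
  by (induction M) auto

lemma LCL_model_fun_upd: "LCL_model S \<rho> \<Longrightarrow> d \<in> carrier S \<Longrightarrow> LCL_model S (\<rho>(x := d))"
  by (auto simp: LCL_model_def)

lemma eq_w_eta_sound:
  assumes "M =\<^sub>w\<^sub>\<eta> N" and "LCL_model S \<rho>"
  shows "interp S \<rho> M = interp S \<rho> N"
  using assms
proof (induction arbitrary: \<rho> rule: eq_w_eta.induct)
  case (eq_S M N L)
  then show ?case
    \<comment> \<open>Inside the case, \<open>eq_S\<close> names the assumption
      \<open>LCL_model S \<rho>\<close>, not the introduction rule; likewise for \<open>eq_K\<close>
      and \<open>eq_I\<close> below.\<close>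
    using interp_in_carrier[OF eq_S]
    by (simp add: LCL_model_def applicative_structure_def Let_def)
next
  case (eq_K M N)
  then show ?case
    using interp_in_carrier[OF eq_K]
    by (simp add: LCL_model_def applicative_structure_def Let_def)
next
  case (eq_I M)
  then show ?case
    using interp_in_carrier[OF eq_I]
    by (simp add: LCL_model_def applicative_structure_def Let_def)
next
  case (eq_ext M x N)
  have "appl S (interp S \<rho> M) d = appl S (interp S \<rho> N) d" if "d \<in> carrier S" for d
    using eq_ext.IH[OF LCL_model_fun_upd[OF eq_ext.prems that, of x]] eq_ext.hyps(2)
    by (simp add: interp_fun_upd_fresh fun_upd_same del: fun_upd_apply)
  moreover have "d\<^sub>1 = d\<^sub>2"
    if "d\<^sub>1 \<in> carrier S" "d\<^sub>2 \<in> carrier S" "\<forall>e\<in>carrier S. appl S d\<^sub>1 e = appl S d\<^sub>2 e" for d\<^sub>1 d\<^sub>2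
    using eq_ext.prems that by (simp add: LCL_model_def applicative_structure_def Let_def)
  ultimately show ?case
    using interp_in_carrier[OF eq_ext.prems] by blast
qed simp_all

lemma LCL_axioms_sound:
  assumes "\<alpha> \<in> LCL_axioms" and "LCL_model S \<rho>"
  shows "sat S \<rho> \<alpha>"
  using assms
proof (induction rule: LCL_axioms.induct)
  case (Ax5 M N \<sigma>)
  then show ?case
    using eq_w_eta_sound by fastforce
\<comment> \<open>Ax1 to Ax3 are the typing conditions on the constants, Ax4 is closure of the sets
  \<open>tyset S \<sigma>\<close> under application, and Ax6 to Ax8 are classical
  tautologies.\<close>
qed (auto simp: LCL_model_def applicative_structure_def Let_def)

text \<open>Modus ponens may draw on any two earlier entries, so the claim covers every position and
  the induction is strong.\<close>

lemma is_proof_sound: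
  assumes "is_proof T \<alpha>s" and "LCL_model S \<rho>" and "\<forall>\<beta>\<in>T. sat S \<rho> \<beta>" and "i < length \<alpha>s"
  shows "sat S \<rho> (\<alpha>s ! i)"
  using assms(4)
proof (induction i rule: less_induct)
  case (less i)
  then consider "\<alpha>s ! i \<in> LCL_axioms" | "\<alpha>s ! i \<in> T"
    | j k where "j < i" "k < i" "\<alpha>s ! k = ((\<alpha>s ! j) \<Rightarrow>\<^sub>f (\<alpha>s ! i))"
    using assms(1) unfolding is_proof_def by blast
  then show ?case
  proof cases
    case 1
    then show ?thesis using LCL_axioms_sound assms(2) by blast
  next
    case 2
    then show ?thesis using assms(3) by blast
  next
    case (3 j k)
    then have "sat S \<rho> (\<alpha>s ! j)" and "sat S \<rho> ((\<alpha>s ! j) \<Rightarrow>\<^sub>f (\<alpha>s ! i))"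
      using less.IH[of j] less.IH[of k] less.prems by auto
    then show ?thesis by simp
  qed
qed

theorem mainTheorem7:
  fixes T :: "('v::countable, 'a) form set" and \<alpha> :: "('v, 'a) form"
  assumes "T \<subseteq> LCL_formulas" and "\<alpha> \<in> LCL_formulas"
    and "T \<turnstile> \<alpha>"
  shows "entails TYPE('d) T \<alpha>"
  unfolding entails_def
proof (intro allI impI)
  fix S :: "('a, 'd) app_struct" and \<rho> :: "'v \<Rightarrow> 'd"
  assume model: "LCL_model S \<rho>" "\<forall>\<beta>\<in>T. sat S \<rho> \<beta>"
  obtain \<alpha>s where "\<alpha>s \<noteq> []" "last \<alpha>s = \<alpha>" "is_proof T \<alpha>s"
    using assms(3) unfolding provable_def by blast
  then show "sat S \<rho> \<alpha>"
    \<comment> \<open>Since \<open>\<alpha>s\<close> is nonempty, its last entry sits at the valid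
      index \<open>length \<alpha>s - 1\<close>.\<close>
    using is_proof_sound[OF _ model, of \<alpha>s "length \<alpha>s - 1"] by (simp add: last_conv_nth)
qed

end
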